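(* Let $X$ be a complex Banach space with open unit ball $B_X$. Let $\varphi:B_X\to B_X$ be holomorphic and such that for every $0<t<1$ there exists $0<\rho<t$ with $$\varphi(tB_X)\subseteq \rho B_X.$$ Then $C_{\varphi^n}\to C_0$ as $n\to\infty$ in the topology of bounded convergence on $H_b(B_X)$. In particular, $(C_\varphi)_{[n]}\to C_0$ in the topology of bounded convergence on $H_b(B_X)$, and $C_\varphi:H_b(B_X)\to H_b(B_X)$ is uniformly mean ergodic.
   Context: A function is holomorphic if it is (complex) Fréchet differentiable at every point. A set $A\subseteq B_X$ is $B_X$-bounded if it is bounded and has positive distance to the boundary of $B_X$ (that is, $A\subseteq rB_X$ for some $0<r<1$). $H_b(B_X)$ is the space of all holomorphic functions $f:B_X\to\mathbb{C}$ that are bounded on every $B_X$-bounded set, with the topology $\tau_b$ of uniform convergence on $B_X$-bounded sets; it is a Fréchet space. $C_\psi(f)=f\circ\psi$ denotes the composition operator with symbol $\psi$, $\varphi^n$ is the $n$-th iterate of $\varphi$, and $C_0$ is the composition operator whose symbol is the constant function $0$, i.e. $C_0(f)$ is the constant function $f(0)$. For a locally convex Hausdorff space $E$, $L(E)$ is the space of continuous linear maps $E\to E$; the topology of bounded convergence of $L(E)$ is that of uniform convergence on bounded subsets of $E$. For $T\in L(E)$, $T_{[n]}=\frac1n\sum_{k=0}^{n-1}T^k$ ($T^0=\mathrm{id}$), and $T$ is uniformly mean ergodic if $(T_{[n]})_n$ converges in the topology of bounded convergence of $L(E)$. *)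

theory Defs
  imports "HOL-Analysis.Analysis"
begin

class complex_vector = real_vector +
  fixes scaleC :: "complex \<Rightarrow> 'a \<Rightarrow> 'a" (infixr "*\<^sub>C" 75)
  assumes scaleC_add_right: "a *\<^sub>C (x + y) = a *\<^sub>C x + a *\<^sub>C y"
    and scaleC_add_left: "(a + b) *\<^sub>C x = a *\<^sub>C x + b *\<^sub>C x"
    and scaleC_scaleC: "a *\<^sub>C (b *\<^sub>C x) = (a * b) *\<^sub>C x"
    and scaleC_of_real: "complex_of_real r *\<^sub>C x = r *\<^sub>R x"

class complex_normed_vector = complex_vector + real_normed_vector +
  assumes norm_scaleC: "norm (a *\<^sub>C x) = norm a * norm x"

class complex_banach = complex_normed_vector + complete_space

class complex_tvs = complex_vector + topological_ab_group_add +
  assumes tendsto_scaleC_Pair: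
      "LIM x (nhds c \<times>\<^sub>F nhds v). fst x *\<^sub>C snd x :> nhds (c *\<^sub>C v)"

text \<open>The second conjunct below is \<open>convex V\<close>, which cannot be used in a class specification.\<close>

class complex_lcs = complex_tvs + t2_space +
  assumes locally_convex:
    "open U \<Longrightarrow> 0 \<in> U \<Longrightarrow> \<exists>V. open V \<and>
       (\<forall>x\<in>V. \<forall>y\<in>V. \<forall>u\<ge>0. \<forall>v\<ge>0. u + v = 1 \<longrightarrow> u *\<^sub>R x + v *\<^sub>R y \<in> V) \<and> 0 \<in> V \<and> V \<subseteq> U"

instantiation complex :: complex_banach
begin

definition scaleC_complex :: "complex \<Rightarrow> complex \<Rightarrow> complex" where
  "scaleC_complex a z = a * z"

instance
  by standard (simp_all add: scaleC_complex_def algebra_simps scaleR_conv_of_real norm_mult)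

end

definition complex_linear :: "('a::complex_vector \<Rightarrow> 'b::complex_vector) \<Rightarrow> bool" where
  "complex_linear T \<longleftrightarrow>
     (\<forall>x y. T (x + y) = T x + T y) \<and> (\<forall>c x. T (c *\<^sub>C x) = c *\<^sub>C T x)"

text \<open>Intended for open \<open>S\<close>, since the derivative is taken at \<open>x\<close> without restriction to \<open>S\<close>.\<close>

definition frechet_holomorphic_on ::
    "('a::complex_normed_vector \<Rightarrow> 'b::complex_normed_vector) \<Rightarrow> 'a set \<Rightarrow> bool" where
  "frechet_holomorphic_on f S \<longleftrightarrow>
     (\<forall>x\<in>S. \<exists>D. complex_linear D \<and> (f has_derivative D) (at x))"

text \<open>The open unit ball \<open>B\<^sub>X\<close> is \<open>ball 0 1\<close>, and \<open>t B\<^sub>X\<close> is \<open>ball 0 t\<close> for \<open>t > 0\<close>.\<close>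

definition BX_bounded :: "'a::complex_normed_vector set \<Rightarrow> bool" where
  "BX_bounded A \<longleftrightarrow> (\<exists>r. 0 < r \<and> r < 1 \<and> A \<subseteq> ball 0 r)"

text \<open>A function on \<open>B\<^sub>X\<close> is encoded as a total function that vanishes outside \<open>B\<^sub>X\<close>; this makes the
  representing function unique.\<close>

definition Hb_functions :: "('a::complex_normed_vector \<Rightarrow> complex) set" where
  "Hb_functions = {f. frechet_holomorphic_on f (ball 0 1) \<and>
     (\<forall>A. BX_bounded A \<longrightarrow> bounded (f ` A)) \<and> (\<forall>x. x \<notin> ball 0 1 \<longrightarrow> f x = 0)}"

lemma complex_linear_zero:
  "complex_linear (\<lambda>x::'a::complex_vector. 0::'b::complex_vector)"
proof -
  have "c *\<^sub>C (0::'b) = 0" for c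
    using scaleC_add_right[of c 0 "0::'b"] by simp
  then show ?thesis
    by (simp add: complex_linear_def)
qed

lemma complex_linear_add:
  "complex_linear D \<Longrightarrow> complex_linear E \<Longrightarrow> complex_linear (\<lambda>x. D x + E x)"
  by (simp add: complex_linear_def scaleC_add_right algebra_simps)

lemma complex_linear_mult:
  fixes D :: "'a::complex_vector \<Rightarrow> complex"
  shows "complex_linear D \<Longrightarrow> complex_linear (\<lambda>x. c * D x)"
  by (simp add: complex_linear_def scaleC_complex_def algebra_simps)

lemma BX_bounded_subset_ball: "BX_bounded A \<Longrightarrow> A \<subseteq> ball 0 1"
  unfolding BX_bounded_def by force

lemma BX_bounded_Un: "BX_bounded A \<Longrightarrow> BX_bounded B \<Longrightarrow> BX_bounded (A \<union> B)"
proof -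
  assume "BX_bounded A" "BX_bounded B"
  then obtain r s where "0 < r" "r < 1" "A \<subseteq> ball 0 r" "0 < s" "s < 1" "B \<subseteq> ball 0 s"
    unfolding BX_bounded_def by auto
  then show ?thesis
    unfolding BX_bounded_def by (intro exI[of _ "max r s"]) auto
qed

lemma BX_bounded_empty: "BX_bounded {}"
  unfolding BX_bounded_def by (rule exI[of _ "1/2"]) auto

lemma BX_bounded_singleton:
  assumes "x \<in> ball 0 1"
  shows "BX_bounded {x}"
proof -
  obtain r where "norm x < r" "r < 1"
    using assms dense[of "norm x" 1] by auto
  moreover from this have "0 < r"
    using norm_ge_zero[of x] by linarith
  ultimately show ?thesis
    unfolding BX_bounded_def by auto
qed

lemma Hb_functions_zero: "(\<lambda>x::'a::complex_normed_vector. 0) \<in> Hb_functions"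
proof -
  have "bounded ((\<lambda>x::'a. 0::complex) ` A)" for A
    unfolding bounded_iff by auto
  moreover have "frechet_holomorphic_on (\<lambda>x::'a. 0::complex) S" for S
    unfolding frechet_holomorphic_on_def
    by (intro ballI exI[of _ "\<lambda>x. 0"] conjI complex_linear_zero has_derivative_const)
  ultimately show ?thesis
    unfolding Hb_functions_def by (intro CollectI conjI allI impI refl)
qed

lemma Hb_functions_deriv:
  assumes "f \<in> Hb_functions" "x \<in> ball 0 1"
  obtains D where "complex_linear D" "(f has_derivative D) (at x)"
proof -
  have "frechet_holomorphic_on f (ball 0 1)"
    using assms(1) unfolding Hb_functions_def by (elim CollectE conjE)
  then show ?thesis
    using assms(2) that unfolding frechet_holomorphic_on_def by metis
qed

lemma Hb_functions_bounded: "f \<in> Hb_functions \<Longrightarrow> BX_bounded A \<Longrightarrow> bounded (f ` A)"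
  unfolding Hb_functions_def by (elim CollectE conjE) metis

lemma Hb_functions_outside: "f \<in> Hb_functions \<Longrightarrow> x \<notin> ball 0 1 \<Longrightarrow> f x = 0"
  unfolding Hb_functions_def by (elim CollectE conjE) metis

lemma Hb_functionsI:
  assumes "\<And>x. x \<in> ball 0 1 \<Longrightarrow> \<exists>D. complex_linear D \<and> (f has_derivative D) (at x)"
    and "\<And>A. BX_bounded A \<Longrightarrow> bounded (f ` A)"
    and "\<And>x. x \<notin> ball 0 1 \<Longrightarrow> f x = 0"
  shows "f \<in> Hb_functions"
  unfolding Hb_functions_def frechet_holomorphic_on_def
  by (intro CollectI conjI ballI allI impI assms)

lemma Hb_functions_add:
  assumes "f \<in> Hb_functions" "g \<in> Hb_functions"
  shows "(\<lambda>x. f x + g x) \<in> Hb_functions"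
proof (rule Hb_functionsI)
  fix x :: 'a assume x: "x \<in> ball 0 1"
  obtain D where D: "complex_linear D" "(f has_derivative D) (at x)"
    by (rule Hb_functions_deriv[OF assms(1) x])
  obtain E where E: "complex_linear E" "(g has_derivative E) (at x)"
    by (rule Hb_functions_deriv[OF assms(2) x])
  show "\<exists>D. complex_linear D \<and> ((\<lambda>x. f x + g x) has_derivative D) (at x)"
    using complex_linear_add[OF D(1) E(1)] has_derivative_add[OF D(2) E(2)] by (intro exI conjI)
next
  fix A :: "'a set" assume A: "BX_bounded A"
  show "bounded ((\<lambda>x. f x + g x) ` A)"
    by (intro bounded_plus_comp Hb_functions_bounded[OF assms(1) A]
        Hb_functions_bounded[OF assms(2) A])
next
  fix x :: 'a assume x: "x \<notin> ball 0 1"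
  show "f x + g x = 0"
    using Hb_functions_outside[OF assms(1) x] Hb_functions_outside[OF assms(2) x] by simp
qed

lemma Hb_functions_mult:
  assumes "f \<in> Hb_functions"
  shows "(\<lambda>x. c * f x) \<in> Hb_functions"
proof (rule Hb_functionsI)
  fix x :: 'a assume x: "x \<in> ball 0 1"
  obtain D where D: "complex_linear D" "(f has_derivative D) (at x)"
    by (rule Hb_functions_deriv[OF assms x])
  show "\<exists>D. complex_linear D \<and> ((\<lambda>x. c * f x) has_derivative D) (at x)"
    using complex_linear_mult[OF D(1)] has_derivative_mult_right[OF D(2)] by (intro exI conjI)
next
  fix A :: "'a set" assume "BX_bounded A"
  then obtain M where M: "\<And>x. x \<in> A \<Longrightarrow> norm (f x) \<le> M"
    using Hb_functions_bounded[OF assms, of A] unfolding bounded_iff by auto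
  have "norm (c * f x) \<le> norm c * M" if "x \<in> A" for x
    using M[OF that] by (simp add: norm_mult mult_left_mono)
  then show "bounded ((\<lambda>x. c * f x) ` A)"
    unfolding bounded_iff by (intro exI[of _ "norm c * M"]) simp
next
  fix x :: 'a assume x: "x \<notin> ball 0 1"
  show "c * f x = 0"
    using Hb_functions_outside[OF assms x] by simp
qed

typedef (overloaded) ('a::complex_banach) Hb = "Hb_functions :: ('a \<Rightarrow> complex) set"
  using Hb_functions_zero by blast

lemma Hb_eqI: "(\<And>x. Rep_Hb f x = Rep_Hb g x) \<Longrightarrow> f = g"
  by (metis Rep_Hb_inject ext)

lemma Rep_Hb_bounded: "BX_bounded A \<Longrightarrow> \<exists>M. \<forall>x\<in>A. norm (Rep_Hb f x) \<le> M"
  using Hb_functions_bounded[OF Rep_Hb, of A f] unfolding bounded_iff by auto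

lemma Rep_Hb_outside: "x \<notin> ball 0 1 \<Longrightarrow> Rep_Hb f x = 0"
  by (rule Hb_functions_outside[OF Rep_Hb])

instantiation Hb :: (complex_banach) real_vector
begin

definition zero_Hb :: "'a Hb" where
  "0 = Abs_Hb (\<lambda>x. 0)"

definition plus_Hb :: "'a Hb \<Rightarrow> 'a Hb \<Rightarrow> 'a Hb" where
  "f + g = Abs_Hb (\<lambda>x. Rep_Hb f x + Rep_Hb g x)"

definition scaleR_Hb :: "real \<Rightarrow> 'a Hb \<Rightarrow> 'a Hb" where
  "r *\<^sub>R f = Abs_Hb (\<lambda>x. complex_of_real r * Rep_Hb f x)"

definition uminus_Hb :: "'a Hb \<Rightarrow> 'a Hb" where
  "- f = Abs_Hb (\<lambda>x. (-1) * Rep_Hb f x)"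

definition minus_Hb :: "'a Hb \<Rightarrow> 'a Hb \<Rightarrow> 'a Hb" where
  "f - g = f + - (g :: 'a Hb)"

lemma Rep_zero_Hb: "Rep_Hb (0 :: 'a Hb) x = 0"
  by (simp add: zero_Hb_def Abs_Hb_inverse Hb_functions_zero)

lemma Rep_plus_Hb: "Rep_Hb (f + g :: 'a Hb) x = Rep_Hb f x + Rep_Hb g x"
  by (simp add: plus_Hb_def Abs_Hb_inverse Hb_functions_add Rep_Hb)

lemma Rep_scaleR_Hb: "Rep_Hb (r *\<^sub>R f :: 'a Hb) x = complex_of_real r * Rep_Hb f x"
  unfolding scaleR_Hb_def by (subst Abs_Hb_inverse) (rule Hb_functions_mult[OF Rep_Hb], rule refl)

lemma Rep_uminus_Hb: "Rep_Hb (- f :: 'a Hb) x = - Rep_Hb f x"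
  unfolding uminus_Hb_def by (subst Abs_Hb_inverse) (rule Hb_functions_mult[OF Rep_Hb], simp)

lemma Rep_minus_Hb: "Rep_Hb (f - g :: 'a Hb) x = Rep_Hb f x - Rep_Hb g x"
  by (simp add: minus_Hb_def Rep_plus_Hb Rep_uminus_Hb)

instance
  by standard
    (rule Hb_eqI, simp add: Rep_zero_Hb Rep_plus_Hb Rep_scaleR_Hb Rep_uminus_Hb Rep_minus_Hb
      algebra_simps)+

end

instantiation Hb :: (complex_banach) complex_vector
begin

definition scaleC_Hb :: "complex \<Rightarrow> 'a Hb \<Rightarrow> 'a Hb" where
  "c *\<^sub>C f = Abs_Hb (\<lambda>x. c * Rep_Hb f x)"

lemma Rep_scaleC_Hb: "Rep_Hb (c *\<^sub>C f :: 'a Hb) x = c * Rep_Hb f x"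
  unfolding scaleC_Hb_def by (subst Abs_Hb_inverse) (rule Hb_functions_mult[OF Rep_Hb], rule refl)

instance
  by standard
    (rule Hb_eqI, simp add: Rep_plus_Hb Rep_scaleC_Hb Rep_scaleR_Hb algebra_simps)+

end

lemmas Rep_Hb_simps =
  Rep_zero_Hb Rep_plus_Hb Rep_scaleC_Hb Rep_scaleR_Hb Rep_uminus_Hb Rep_minus_Hb

text \<open>The topology \<open>\<tau>\<^sub>b\<close> of uniform convergence on the \<open>B\<^sub>X\<close>-bounded sets.\<close>

definition Hb_nbhd :: "'a::complex_banach Hb \<Rightarrow> 'a set \<Rightarrow> real \<Rightarrow> 'a Hb set" where
  "Hb_nbhd f A e = {g. \<forall>x\<in>A. norm (Rep_Hb g x - Rep_Hb f x) < e}"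

instantiation Hb :: (complex_banach) topological_space
begin

definition open_Hb :: "'a Hb set \<Rightarrow> bool" where
  "open U \<longleftrightarrow> (\<forall>f\<in>U. \<exists>A e. BX_bounded A \<and> 0 < e \<and> Hb_nbhd f A e \<subseteq> U)"

instance
proof
  show "open (UNIV :: 'a Hb set)"
    unfolding open_Hb_def using BX_bounded_empty by (auto intro!: exI[of _ "1::real"])
next
  fix U V :: "'a Hb set"
  assume U: "open U" and V: "open V"
  show "open (U \<inter> V)"
    unfolding open_Hb_def
  proof
    fix f assume f: "f \<in> U \<inter> V"
    obtain A d where A: "BX_bounded A" "0 < d" "Hb_nbhd f A d \<subseteq> U"
      using U f unfolding open_Hb_def by blast
    obtain B e where B: "BX_bounded B" "0 < e" "Hb_nbhd f B e \<subseteq> V"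
      using V f unfolding open_Hb_def by blast
    have "Hb_nbhd f (A \<union> B) (min d e) \<subseteq> Hb_nbhd f A d \<inter> Hb_nbhd f B e"
      unfolding Hb_nbhd_def by auto
    then show "\<exists>C e. BX_bounded C \<and> 0 < e \<and> Hb_nbhd f C e \<subseteq> U \<inter> V"
      using A B by (intro exI[of _ "A \<union> B"] exI[of _ "min d e"]) (auto simp: BX_bounded_Un)
  qed
next
  fix K :: "'a Hb set set"
  assume K: "\<forall>U\<in>K. open U"
  show "open (\<Union>K)"
    unfolding open_Hb_def
  proof
    fix f assume "f \<in> \<Union>K"
    then obtain U where U: "U \<in> K" "f \<in> U"
      by blast
    then have "open U"
      using K by blast
    then obtain A e where A: "BX_bounded A" "0 < e" "Hb_nbhd f A e \<subseteq> U"
      using U(2) unfolding open_Hb_def by metis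
    moreover have "Hb_nbhd f A e \<subseteq> \<Union>K"
      using A(3) U(1) by blast
    ultimately show "\<exists>A e. BX_bounded A \<and> 0 < e \<and> Hb_nbhd f A e \<subseteq> \<Union>K"
      by metis
  qed
qed

end

definition Hb_inner :: "'a::complex_banach Hb \<Rightarrow> 'a set \<Rightarrow> real \<Rightarrow> 'a Hb set" where
  "Hb_inner f A e = {g. \<exists>d<e. \<forall>x\<in>A. norm (Rep_Hb g x - Rep_Hb f x) \<le> d}"

lemma Hb_inner_subset: "Hb_inner f A e \<subseteq> Hb_nbhd f A e"
  unfolding Hb_inner_def Hb_nbhd_def by force

lemma mem_Hb_inner: "0 < e \<Longrightarrow> f \<in> Hb_inner f A e"
  unfolding Hb_inner_def by auto

lemma open_Hb_inner:
  assumes "BX_bounded A"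
  shows "open (Hb_inner f A e)"
  unfolding open_Hb_def
proof
  fix g assume "g \<in> Hb_inner f A e"
  then obtain d where d: "d < e" "\<And>x. x \<in> A \<Longrightarrow> norm (Rep_Hb g x - Rep_Hb f x) \<le> d"
    unfolding Hb_inner_def by auto
  have "Hb_nbhd g A ((e - d) / 2) \<subseteq> Hb_inner f A e"
  proof
    fix h assume h: "h \<in> Hb_nbhd g A ((e - d) / 2)"
    have "norm (Rep_Hb h x - Rep_Hb f x) \<le> (e + d) / 2" if "x \<in> A" for x
    proof -
      have "norm (Rep_Hb h x - Rep_Hb g x) < (e - d) / 2"
        using h that unfolding Hb_nbhd_def by blast
      moreover have "norm (Rep_Hb h x - Rep_Hb f x)
          \<le> norm (Rep_Hb h x - Rep_Hb g x) + norm (Rep_Hb g x - Rep_Hb f x)"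
        using norm_triangle_ineq[of "Rep_Hb h x - Rep_Hb g x" "Rep_Hb g x - Rep_Hb f x"] by simp
      ultimately show ?thesis
        using d(2)[OF that] by argo
    qed
    moreover have "(e + d) / 2 < e"
      using d(1) by simp
    ultimately show "h \<in> Hb_inner f A e"
      unfolding Hb_inner_def by blast
  qed
  then show "\<exists>B u. BX_bounded B \<and> 0 < u \<and> Hb_nbhd g B u \<subseteq> Hb_inner f A e"
    using assms d(1) by (intro exI[of _ A] exI[of _ "(e - d) / 2"]) auto
qed

lemma eventually_Hb_nbhd:
  assumes "BX_bounded A" "0 < e"
  shows "eventually (\<lambda>g. g \<in> Hb_nbhd f A e) (nhds f)"
proof -
  have "\<forall>g\<in>Hb_inner f A e. g \<in> Hb_nbhd f A e"
    using Hb_inner_subset[of f A e] by (simp add: subset_iff)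
  then show ?thesis
    unfolding eventually_nhds
    using open_Hb_inner[OF assms(1), of f e] mem_Hb_inner[OF assms(2), of f A] by metis
qed

lemma open_Hb_nbhd:
  assumes "open U" "f \<in> U"
  obtains A e where "BX_bounded A" "0 < e" "Hb_nbhd f A e \<subseteq> U"
  using assms unfolding open_Hb_def by metis

lemma filterlim_nhds_HbI:
  assumes "\<And>A e. BX_bounded A \<Longrightarrow> 0 < e \<Longrightarrow> eventually (\<lambda>y. F y \<in> Hb_nbhd f A e) G"
  shows "filterlim F (nhds f) G"
proof (rule topological_tendstoI)
  fix U assume U: "open U" "f \<in> U"
  obtain A e where A: "BX_bounded A" "0 < e" "Hb_nbhd f A e \<subseteq> U"
    by (rule open_Hb_nbhd[OF U])
  show "eventually (\<lambda>y. F y \<in> U) G"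
    using assms[OF A(1,2)] by (rule eventually_mono) (rule subsetD[OF A(3)])
qed

instance Hb :: (complex_banach) complex_lcs
proof
  fix a b :: "'a Hb"
  show "LIM x (nhds a \<times>\<^sub>F nhds b). fst x + snd x :> nhds (a + b)"
  proof (rule filterlim_nhds_HbI)
    fix A :: "'a set" and e :: real
    assume A: "BX_bounded A" "0 < e"
    show "eventually (\<lambda>x. fst x + snd x \<in> Hb_nbhd (a + b) A e) (nhds a \<times>\<^sub>F nhds b)"
      unfolding eventually_prod_filter
    proof (intro exI conjI allI impI)
      show "eventually (\<lambda>g. g \<in> Hb_nbhd a A (e/2)) (nhds a)"
           "eventually (\<lambda>g. g \<in> Hb_nbhd b A (e/2)) (nhds b)"
        using A by (auto intro: eventually_Hb_nbhd)
      fix f g assume f: "f \<in> Hb_nbhd a A (e/2)" and g: "g \<in> Hb_nbhd b A (e/2)"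
      have "norm (Rep_Hb (f + g) x - Rep_Hb (a + b) x) < e" if "x \<in> A" for x
      proof -
        have "norm (Rep_Hb f x - Rep_Hb a x) < e/2" "norm (Rep_Hb g x - Rep_Hb b x) < e/2"
          using f g that unfolding Hb_nbhd_def by auto
        then have "norm ((Rep_Hb f x - Rep_Hb a x) + (Rep_Hb g x - Rep_Hb b x)) < e"
          using norm_triangle_ineq[of "Rep_Hb f x - Rep_Hb a x" "Rep_Hb g x - Rep_Hb b x"]
          by linarith
        then show ?thesis
          by (simp add: Rep_plus_Hb algebra_simps)
      qed
      then show "fst (f, g) + snd (f, g) \<in> Hb_nbhd (a + b) A e"
        unfolding Hb_nbhd_def by simp
    qed
  qed
next
  fix a :: "'a Hb"
  show "(uminus \<longlongrightarrow> - a) (nhds a)"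
  proof (rule filterlim_nhds_HbI)
    fix A :: "'a set" and e :: real
    assume A: "BX_bounded A" "0 < e"
    have "- g \<in> Hb_nbhd (- a) A e" if "g \<in> Hb_nbhd a A e" for g
      using that unfolding Hb_nbhd_def by (simp add: Rep_uminus_Hb norm_minus_commute)
    then show "eventually (\<lambda>g. - g \<in> Hb_nbhd (- a) A e) (nhds a)"
      by (rule eventually_mono[OF eventually_Hb_nbhd[OF A]])
  qed
next
  fix f g :: "'a Hb"
  assume "f \<noteq> g"
  then obtain x where x: "Rep_Hb f x \<noteq> Rep_Hb g x"
    using Hb_eqI by blast
  then have "x \<in> ball 0 1"
    by (metis Rep_Hb_outside)
  then have A: "BX_bounded {x}"
    by (rule BX_bounded_singleton)
  define e where "e = norm (Rep_Hb f x - Rep_Hb g x) / 2"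
  have e: "0 < e"
    using x unfolding e_def by simp
  have "Hb_inner f {x} e \<inter> Hb_inner g {x} e = {}"
  proof -
    have False if h: "h \<in> Hb_nbhd f {x} e" "h \<in> Hb_nbhd g {x} e" for h
    proof -
      have "norm (Rep_Hb h x - Rep_Hb f x) < e" "norm (Rep_Hb h x - Rep_Hb g x) < e"
        using h unfolding Hb_nbhd_def by auto
      moreover have "norm (Rep_Hb f x - Rep_Hb g x)
          \<le> norm (Rep_Hb h x - Rep_Hb f x) + norm (Rep_Hb h x - Rep_Hb g x)"
        using norm_triangle_ineq4[of "Rep_Hb h x - Rep_Hb g x" "Rep_Hb h x - Rep_Hb f x"]
        by simp
      ultimately show False
        unfolding e_def by argo
    qed
    then show ?thesis
      using Hb_inner_subset[of f "{x}" e] Hb_inner_subset[of g "{x}" e] by blast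
  qed
  then show "\<exists>U V. open U \<and> open V \<and> f \<in> U \<and> g \<in> V \<and> U \<inter> V = {}"
    using open_Hb_inner[OF A] mem_Hb_inner[OF e] by metis
next
  fix c :: complex and v :: "'a Hb"
  show "LIM x (nhds c \<times>\<^sub>F nhds v). fst x *\<^sub>C snd x :> nhds (c *\<^sub>C v)"
  proof (rule filterlim_nhds_HbI)
    fix A :: "'a set" and e :: real
    assume A: "BX_bounded A" "0 < e"
    obtain M0 where M0: "\<And>x. x \<in> A \<Longrightarrow> norm (Rep_Hb v x) \<le> M0"
      using Rep_Hb_bounded[OF A(1)] by blast
    define M where "M = max M0 0 + 1"
    have M: "0 < M" "\<And>x. x \<in> A \<Longrightarrow> norm (Rep_Hb v x) \<le> M"
      using M0 unfolding M_def by force+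
    define d where "d = min 1 (e / (2 * M))"
    define d' where "d' = e / (2 * (norm c + 1))"
    have c1: "0 < norm c + 1"
      by (simp add: add_nonneg_pos)
    have d: "0 < d" "d \<le> 1" "d * M \<le> e / 2"
      using A(2) M(1) unfolding d_def by (auto simp: field_simps min_def)
    have d': "0 < d'" "(norm c + 1) * d' = e / 2"
      using A(2) c1 unfolding d'_def by (simp, simp add: divide_simps)
    show "eventually (\<lambda>x. fst x *\<^sub>C snd x \<in> Hb_nbhd (c *\<^sub>C v) A e) (nhds c \<times>\<^sub>F nhds v)"
      unfolding eventually_prod_filter
    proof (intro exI conjI allI impI)
      show "eventually (\<lambda>b. dist b c < d) (nhds c)"
        using d(1) unfolding eventually_nhds_metric by metis
      show "eventually (\<lambda>g. g \<in> Hb_nbhd v A d') (nhds v)"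
        using A d' by (auto intro: eventually_Hb_nbhd)
      fix b g assume b: "dist b c < d" and g: "g \<in> Hb_nbhd v A d'"
      have "norm (Rep_Hb (b *\<^sub>C g) x - Rep_Hb (c *\<^sub>C v) x) < e" if "x \<in> A" for x
      proof -
        have g': "norm (Rep_Hb g x - Rep_Hb v x) < d'"
          using g that unfolding Hb_nbhd_def by auto
        have b': "norm b \<le> norm c + 1" "norm (b - c) \<le> d"
          using b d(2) norm_triangle_sub[of b c] by (auto simp: dist_norm)
        have "Rep_Hb (b *\<^sub>C g) x - Rep_Hb (c *\<^sub>C v) x
            = b * (Rep_Hb g x - Rep_Hb v x) + (b - c) * Rep_Hb v x"
          by (simp add: Rep_scaleC_Hb algebra_simps)
        then have "norm (Rep_Hb (b *\<^sub>C g) x - Rep_Hb (c *\<^sub>C v) x)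
            \<le> norm b * norm (Rep_Hb g x - Rep_Hb v x) + norm (b - c) * norm (Rep_Hb v x)"
          by (metis norm_mult norm_triangle_ineq)
        moreover have "norm b * norm (Rep_Hb g x - Rep_Hb v x)
            \<le> (norm c + 1) * norm (Rep_Hb g x - Rep_Hb v x)"
          using b'(1) by (intro mult_right_mono) auto
        moreover have "(norm c + 1) * norm (Rep_Hb g x - Rep_Hb v x) < e / 2"
          using g' c1 d'(2) mult_strict_left_mono by metis
        moreover have "norm (b - c) * norm (Rep_Hb v x) \<le> d * M"
          using b'(2) M(2)[OF that] d(1) by (intro mult_mono) auto
        ultimately show ?thesis
          using d(3) by argo
      qed
      then show "fst (b, g) *\<^sub>C snd (b, g) \<in> Hb_nbhd (c *\<^sub>C v) A e"
        unfolding Hb_nbhd_def by simp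
    qed
  qed
next
  fix U :: "'a Hb set"
  assume "open U" "0 \<in> U"
  then obtain A e where A: "BX_bounded A" "0 < e" "Hb_nbhd 0 A e \<subseteq> U"
    by (rule open_Hb_nbhd)
  have "convex (Hb_inner 0 A e)"
    unfolding convex_def
  proof (intro ballI allI impI)
    fix f g :: "'a Hb" and u v :: real
    assume f: "f \<in> Hb_inner 0 A e" and g: "g \<in> Hb_inner 0 A e"
      and uv: "0 \<le> u" "0 \<le> v" "u + v = 1"
    obtain d where d: "d < e" "\<And>x. x \<in> A \<Longrightarrow> norm (Rep_Hb f x) \<le> d"
      using f unfolding Hb_inner_def by (auto simp: Rep_zero_Hb)
    obtain d' where d': "d' < e" "\<And>x. x \<in> A \<Longrightarrow> norm (Rep_Hb g x) \<le> d'"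
      using g unfolding Hb_inner_def by (auto simp: Rep_zero_Hb)
    have "norm (Rep_Hb (u *\<^sub>R f + v *\<^sub>R g) x) \<le> max d d'" if "x \<in> A" for x
    proof -
      have "norm (Rep_Hb (u *\<^sub>R f + v *\<^sub>R g) x) \<le> u * norm (Rep_Hb f x) + v * norm (Rep_Hb g x)"
        using uv norm_triangle_ineq[of "u * Rep_Hb f x" "v * Rep_Hb g x"]
        by (simp add: Rep_Hb_simps norm_mult)
      also have "\<dots> \<le> u * max d d' + v * max d d'"
        using uv d(2)[OF that] d'(2)[OF that]
        by (intro add_mono mult_left_mono) auto
      also have "\<dots> = max d d'"
        using uv by (metis distrib_right mult_1)
      finally show ?thesis .
    qed
    then show "u *\<^sub>R f + v *\<^sub>R g \<in> Hb_inner 0 A e"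
      unfolding Hb_inner_def using d(1) d'(1)
      by (auto simp: Rep_zero_Hb intro!: exI[of _ "max d d'"])
  qed
  then show "\<exists>V. open V \<and>
      (\<forall>x\<in>V. \<forall>y\<in>V. \<forall>u\<ge>0. \<forall>v\<ge>0. u + v = 1 \<longrightarrow> u *\<^sub>R x + v *\<^sub>R y \<in> V) \<and> 0 \<in> V \<and> V \<subseteq> U"
    unfolding convex_def[symmetric]
    using A(3) open_Hb_inner[OF A(1)] mem_Hb_inner[OF A(2)] Hb_inner_subset[of 0 A e]
    by (intro exI[of _ "Hb_inner 0 A e"]) auto
qed

definition lin_ops :: "('e::complex_lcs \<Rightarrow> 'e) set" where
  "lin_ops = {T. complex_linear T \<and> continuous_on UNIV T}"

definition vN_bounded :: "'e::complex_lcs set \<Rightarrow> bool" where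
  "vN_bounded B \<longleftrightarrow>
     (\<forall>U. open U \<and> 0 \<in> U \<longrightarrow> (\<exists>s>0. \<forall>c. s \<le> norm c \<longrightarrow> B \<subseteq> (\<lambda>v. c *\<^sub>C v) ` U))"

text \<open>The topology on \<open>L(E)\<close> in which the sets \<open>{S. \<forall>v\<in>B. S v - T v \<in> U}\<close>, with \<open>B\<close> bounded and \<open>U\<close>
  a zero-neighbourhood, form a base of neighbourhoods of \<open>T\<close>.\<close>

definition bc_topology :: "('e::complex_lcs \<Rightarrow> 'e) topology" where
  "bc_topology = topology (\<lambda>W. W \<subseteq> lin_ops \<and>
     (\<forall>T\<in>W. \<exists>B U. vN_bounded B \<and> open U \<and> 0 \<in> U \<and>
        {S \<in> lin_ops. \<forall>v\<in>B. S v - T v \<in> U} \<subseteq> W))"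

lemma vN_bounded_empty: "vN_bounded {}"
  unfolding vN_bounded_def by (auto intro: exI[of _ "1::real"])

lemma vN_bounded_Un:
  assumes "vN_bounded A" "vN_bounded B"
  shows "vN_bounded (A \<union> B)"
  unfolding vN_bounded_def
proof (intro allI impI)
  fix U :: "'a set"
  assume U: "open U \<and> 0 \<in> U"
  obtain r where r: "r > 0" "\<And>c. r \<le> norm c \<Longrightarrow> A \<subseteq> (\<lambda>v. c *\<^sub>C v) ` U"
    using assms(1) U unfolding vN_bounded_def by blast
  obtain s where s: "s > 0" "\<And>c. s \<le> norm c \<Longrightarrow> B \<subseteq> (\<lambda>v. c *\<^sub>C v) ` U"
    using assms(2) U unfolding vN_bounded_def by blast
  show "\<exists>s>0. \<forall>c. s \<le> norm c \<longrightarrow> A \<union> B \<subseteq> (\<lambda>v. c *\<^sub>C v) ` U"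
    using r s by (intro exI[of _ "max r s"]) auto
qed

lemma openin_bc_topology:
  "openin bc_topology W \<longleftrightarrow> W \<subseteq> lin_ops \<and>
     (\<forall>T\<in>W. \<exists>B U. vN_bounded B \<and> open U \<and> 0 \<in> U \<and>
        {S \<in> lin_ops. \<forall>v\<in>B. S v - T v \<in> U} \<subseteq> W)"
proof -
  define N :: "('a \<Rightarrow> 'a) \<Rightarrow> 'a set \<Rightarrow> 'a set \<Rightarrow> ('a \<Rightarrow> 'a) set"
    where "N T B U = {S \<in> lin_ops. \<forall>v\<in>B. S v - T v \<in> U}" for T B U
  have "istopology (\<lambda>W. W \<subseteq> lin_ops \<and>
     (\<forall>T\<in>W. \<exists>B U. vN_bounded B \<and> open U \<and> 0 \<in> U \<and> N T B U \<subseteq> W))"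
    unfolding istopology_def
  proof (intro conjI allI impI ballI)
    fix V W T
    assume V: "V \<subseteq> lin_ops \<and> (\<forall>T\<in>V. \<exists>B U. vN_bounded B \<and> open U \<and> 0 \<in> U \<and> N T B U \<subseteq> V)"
      and W: "W \<subseteq> lin_ops \<and> (\<forall>T\<in>W. \<exists>B U. vN_bounded B \<and> open U \<and> 0 \<in> U \<and> N T B U \<subseteq> W)"
    show "V \<inter> W \<subseteq> lin_ops"
      using V by blast
    assume T: "T \<in> V \<inter> W"
    obtain B U where B: "vN_bounded B" "open U" "0 \<in> U" "N T B U \<subseteq> V"
      using V T by blast
    obtain B' U' where B': "vN_bounded B'" "open U'" "0 \<in> U'" "N T B' U' \<subseteq> W"
      using W T by blast
    have "N T (B \<union> B') (U \<inter> U') \<subseteq> V \<inter> W"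
      using B(4) B'(4) unfolding N_def by auto
    then show "\<exists>B U. vN_bounded B \<and> open U \<and> 0 \<in> U \<and> N T B U \<subseteq> V \<inter> W"
      using vN_bounded_Un[OF B(1) B'(1)] open_Int[OF B(2) B'(2)] B(3) B'(3) by blast
  next
    fix K T
    assume K: "\<forall>V\<in>K. V \<subseteq> lin_ops \<and>
      (\<forall>T\<in>V. \<exists>B U. vN_bounded B \<and> open U \<and> 0 \<in> U \<and> N T B U \<subseteq> V)"
    then show "\<Union>K \<subseteq> lin_ops"
      by blast
    assume "T \<in> \<Union>K"
    then obtain V where V: "V \<in> K" "T \<in> V"
      by blast
    then obtain B U where "vN_bounded B" "open U" "0 \<in> U" "N T B U \<subseteq> V"
      using K by blast
    then show "\<exists>B U. vN_bounded B \<and> open U \<and> 0 \<in> U \<and> N T B U \<subseteq> \<Union>K"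
      using V(1) by blast
  qed
  then show ?thesis
    unfolding bc_topology_def N_def by (simp add: topology_inverse')
qed

lemma topspace_bc_topology: "topspace bc_topology = (lin_ops :: ('e::complex_lcs \<Rightarrow> 'e) set)"
proof
  have "openin bc_topology (lin_ops :: ('e \<Rightarrow> 'e) set)"
    unfolding openin_bc_topology
  proof (intro conjI subset_refl ballI)
    fix T :: "'e \<Rightarrow> 'e"
    show "\<exists>B U. vN_bounded B \<and> open U \<and> 0 \<in> U \<and>
        {S \<in> lin_ops. \<forall>v\<in>B. S v - T v \<in> U} \<subseteq> lin_ops"
      using vN_bounded_empty open_UNIV by (intro exI[of _ "{}"] exI[of _ UNIV]) simp
  qed
  then show "lin_ops \<subseteq> topspace (bc_topology :: ('e \<Rightarrow> 'e) topology)"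
    by (rule openin_subset)
  show "topspace bc_topology \<subseteq> (lin_ops :: ('e \<Rightarrow> 'e) set)"
    using openin_topspace[of "bc_topology :: ('e \<Rightarrow> 'e) topology"]
    unfolding openin_bc_topology by simp
qed

definition cesaro_mean :: "('e::complex_lcs \<Rightarrow> 'e) \<Rightarrow> nat \<Rightarrow> 'e \<Rightarrow> 'e" where
  "cesaro_mean T n = (\<lambda>v. (1 / of_nat n) *\<^sub>C (\<Sum>k<n. (T ^^ k) v))"

definition uniformly_mean_ergodic :: "('e::complex_lcs \<Rightarrow> 'e) \<Rightarrow> bool" where
  "uniformly_mean_ergodic T \<longleftrightarrow>
     T \<in> lin_ops \<and> (\<exists>P. limitin bc_topology (cesaro_mean T) P sequentially)"

text \<open>\<open>Abs_Hb\<close> is only meaningful if the composite belongs to \<open>H\<^sub>b(B\<^sub>X)\<close>; \<open>Rep_comp_op\<close> below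
  shows that this is so for every holomorphic self-map of \<open>B\<^sub>X\<close> that preserves \<open>B\<^sub>X\<close>-boundedness.\<close>

definition comp_op :: "('a::complex_banach \<Rightarrow> 'a) \<Rightarrow> 'a Hb \<Rightarrow> 'a Hb" where
  "comp_op \<psi> f = Abs_Hb (\<lambda>x. if x \<in> ball 0 1 then Rep_Hb f (\<psi> x) else 0)"

lemma Rep_comp_op:
  assumes hol: "frechet_holomorphic_on \<psi> (ball 0 1)"
    and self: "\<psi> ` ball 0 1 \<subseteq> ball 0 1"
    and bdd: "\<And>A. BX_bounded A \<Longrightarrow> BX_bounded (\<psi> ` A)"
  shows "Rep_Hb (comp_op \<psi> f) x = (if x \<in> ball 0 1 then Rep_Hb f (\<psi> x) else 0)"
proof -
  let ?g = "\<lambda>x. if x \<in> ball 0 1 then Rep_Hb f (\<psi> x) else 0"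
  have "?g \<in> Hb_functions"
  proof (rule Hb_functionsI)
    fix x :: 'a assume x: "x \<in> ball 0 1"
    obtain D where D: "complex_linear D" "(\<psi> has_derivative D) (at x)"
      using hol x unfolding frechet_holomorphic_on_def by metis
    have "\<psi> x \<in> ball 0 1"
      using self x by blast
    then obtain E where E: "complex_linear E" "(Rep_Hb f has_derivative E) (at (\<psi> x))"
      by (rule Hb_functions_deriv[OF Rep_Hb])
    have "((\<lambda>y. Rep_Hb f (\<psi> y)) has_derivative (\<lambda>h. E (D h))) (at x)"
      using diff_chain_at[OF D(2) E(2)] by (simp only: o_def)
    then have "(?g has_derivative (\<lambda>h. E (D h))) (at x)"
      by (rule has_derivative_transform_within_open[OF _ open_ball x]) simp
    moreover have "complex_linear (\<lambda>h. E (D h))"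
      using D(1) E(1) unfolding complex_linear_def by simp
    ultimately show "\<exists>D. complex_linear D \<and> (?g has_derivative D) (at x)"
      by (intro exI conjI)
  next
    fix A :: "'a set" assume A: "BX_bounded A"
    obtain M where "\<forall>y\<in>\<psi> ` A. norm (Rep_Hb f y) \<le> M"
      using Rep_Hb_bounded[OF bdd[OF A]] by metis
    then have "norm (?g x) \<le> M" if "x \<in> A" for x
      using BX_bounded_subset_ball[OF A] that by (simp add: subset_iff)
    then show "bounded (?g ` A)"
      unfolding bounded_iff by (intro exI[of _ M] ballI) (elim imageE, simp only:)
  qed simp
  then show ?thesis
    unfolding comp_op_def by (simp only: Abs_Hb_inverse)
qed

end

theory Submission
  imports Defs "HOL-Complex_Analysis.Conformal_Mappings"
begin

text \<open>
  The one analytic ingredient is the classical Schwarz lemma, applied to the scalar functions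
  \<open>f \<in> H\<^sub>b(B\<^sub>X)\<close> on complex lines through the origin and not to the vector-valued map \<open>\<phi>\<close>: if
  \<open>\<bar>f - f(0)\<bar> \<le> K\<close> on \<open>t B\<^sub>X\<close>, then \<open>\<bar>f - f(0)\<bar> \<le> (\<rho>/t) K\<close> on \<open>\<rho> B\<^sub>X\<close>
  (\<open>Schwarz_ball\<close>). Now let \<open>\<phi>(t B\<^sub>X) \<subseteq> \<rho> B\<^sub>X\<close> with \<open>\<rho> < t\<close>. The hypothesis for
  all small radii forces \<open>\<phi>(0) = 0\<close>, so \<open>C\<^sub>\<phi> f\<close> takes the same value at \<open>0\<close> as \<open>f\<close>, and
  passing from \<open>f\<close> to \<open>C\<^sub>\<phi> f\<close> multiplies the supremum of \<open>\<bar>f - f(0)\<bar>\<close> over the fixed ball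
  \<open>t B\<^sub>X\<close> by at most \<open>q = \<rho>/t < 1\<close>. Iterating,
  \[ \sup_{t B_X} |f \circ \varphi^n - f(0)| \le 2 q^n \sup_{t B_X} |f| \]
  (\<open>comp_op_funpow_geometric\<close>). Working with \<open>f\<close> in place of \<open>\<phi>\<close> avoids both a Schwarz lemma
  for Banach-space-valued maps and the norming functionals that it would need.

  A bounded set of \<open>H\<^sub>b(B\<^sub>X)\<close> is uniformly bounded on each \<open>t B\<^sub>X\<close>, and the balls \<open>t B\<^sub>X\<close>,
  \<open>t < 1\<close>, define the topology, so a bound \<open>c\<^sub>n sup \<bar>f\<bar>\<close> with \<open>c\<^sub>n \<rightarrow> 0\<close> on each of them is
  convergence in the topology of bounded convergence (\<open>limitin_bc_topologyI\<close>). For the iterates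
  \<open>c\<^sub>n = 2 q\<^sup>n\<close>; for the Cesaro means, averaging the geometric bounds gives
  \<open>c\<^sub>n = 2 / (n (1 - q))\<close>. Uniform mean ergodicity is the second convergence with the limit
  forgotten.
\<close>

section \<open>The Schwarz lemma on balls of a complex normed space\<close>

lemma bounded_linear_scaleC_left:
  "bounded_linear (\<lambda>z. z *\<^sub>C (u :: 'a::complex_normed_vector))"
proof (rule bounded_linear_intro[where K = "norm u"])
  fix z w :: complex and s :: real
  show "(z + w) *\<^sub>C u = z *\<^sub>C u + w *\<^sub>C u"
    by (rule scaleC_add_left)
  show "(s *\<^sub>R z) *\<^sub>C u = s *\<^sub>R z *\<^sub>C u"
    by (simp add: scaleR_conv_of_real scaleC_scaleC[symmetric] scaleC_of_real)
  show "norm (z *\<^sub>C u) \<le> norm z * norm u"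
    by (simp add: norm_scaleC)
qed

text \<open>Restricting a Frechet holomorphic function to a complex line through the origin gives a
  function of one complex variable, because the derivative is complex linear along that line.\<close>

lemma holomorphic_on_slice:
  fixes f :: "'a::complex_normed_vector \<Rightarrow> complex"
  assumes "frechet_holomorphic_on f S" and "\<And>z. z \<in> T \<Longrightarrow> z *\<^sub>C u \<in> S"
  shows "(\<lambda>z. f (z *\<^sub>C u)) holomorphic_on T"
  unfolding holomorphic_on_def
proof
  fix z assume "z \<in> T"
  then obtain D where D: "complex_linear D" "(f has_derivative D) (at (z *\<^sub>C u))"
    using assms unfolding frechet_holomorphic_on_def by metis
  have "((\<lambda>z. z *\<^sub>C u) has_derivative (\<lambda>h. h *\<^sub>C u)) (at z)"
    by (rule bounded_linear_imp_has_derivative[OF bounded_linear_scaleC_left])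
  from diff_chain_at[OF this D(2)]
  have "((\<lambda>z. f (z *\<^sub>C u)) has_derivative (\<lambda>h. D (h *\<^sub>C u))) (at z)"
    by (simp only: o_def)
  moreover have "(\<lambda>h. D (h *\<^sub>C u)) = (*) (D u)"
    using D(1) by (auto simp: complex_linear_def scaleC_complex_def mult.commute)
  ultimately have "((\<lambda>z. f (z *\<^sub>C u)) has_field_derivative D u) (at z)"
    by (simp add: has_field_derivative_def)
  then show "(\<lambda>z. f (z *\<^sub>C u)) field_differentiable (at z within T)"
    using field_differentiable_def field_differentiable_at_within by blast
qed

lemma Schwarz_ball:
  fixes f :: "'a::complex_normed_vector \<Rightarrow> complex"
  assumes hol: "frechet_holomorphic_on f (ball 0 r)"
    and K: "\<And>y. y \<in> ball 0 r \<Longrightarrow> norm (f y - f 0) \<le> K"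
    and x: "x \<in> ball 0 r"
  shows "norm (f x - f 0) \<le> K * (norm x / r)"
proof (cases "x = 0")
  case True
  then show ?thesis by simp
next
  case False
  have r: "0 < r"
    using x norm_ge_zero[of x] by (simp del: norm_ge_zero)
  have K0: "0 \<le> K"
    using K[of 0] r by simp
  define u where "u = (r / norm x) *\<^sub>R x"
  have u: "norm u = r"
    using False r unfolding u_def by simp
  have xu: "complex_of_real (norm x / r) *\<^sub>C u = x"
    unfolding u_def scaleC_of_real using False r by simp
  have slice: "z *\<^sub>C u \<in> ball 0 r" if "norm z < 1" for z
    using that r by (simp add: norm_scaleC u)
  have zero: "0 *\<^sub>C u = 0"
    using scaleC_of_real[of 0 u] by simp
  \<comment> \<open>The one-variable Schwarz lemma asks for a strict bound, so it is applied with every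
    constant larger than \<open>K\<close>.\<close>
  have bound: "norm (f x - f 0) \<le> L * (norm x / r)" if L: "K < L" for L
  proof -
    let ?g = "\<lambda>z. (f (z *\<^sub>C u) - f 0) / complex_of_real L"
    have L0: "0 < L"
      using K0 L by simp
    have "norm (?g (complex_of_real (norm x / r))) \<le> norm (complex_of_real (norm x / r))"
    proof (rule Schwarz_Lemma(1))
      show "?g holomorphic_on ball 0 1"
        using L0 slice by (intro holomorphic_intros holomorphic_on_slice[OF hol]) auto
      show "?g 0 = 0"
        by (simp add: zero)
      show "norm (?g z) < 1" if "norm z < 1" for z
        using K[OF slice[OF that]] L L0 by (simp add: norm_divide)
      show "norm (complex_of_real (norm x / r)) < 1"
        using x r by (simp add: norm_divide)
    qed
    then show ?thesis
      unfolding xu using L0 r by (simp add: norm_divide field_simps)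
  qed
  have "norm (f x - f 0) / (norm x / r) \<le> L" if "K < L" for L
    using bound[OF that] False r by (simp add: field_simps)
  then have "norm (f x - f 0) / (norm x / r) \<le> K"
    by (rule dense_ge)
  then show ?thesis
    using False r by (simp add: field_simps)
qed

section \<open>Composition with norm-decreasing self-maps of the ball\<close>

text \<open>Such a map sends every \<open>r B\<^sub>X\<close> into itself, so its composition operator acts on
  \<open>H\<^sub>b(B\<^sub>X)\<close>. The class contains all iterates of \<open>\<phi>\<close> as well as the constant \<open>0\<close>.\<close>

definition norm_decreasing_map :: "('a::complex_normed_vector \<Rightarrow> 'a) \<Rightarrow> bool" where
  "norm_decreasing_map \<psi> \<longleftrightarrow>
     frechet_holomorphic_on \<psi> (ball 0 1) \<and> (\<forall>x\<in>ball 0 1. norm (\<psi> x) \<le> norm x)"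

lemma norm_decreasing_map_zero: "norm_decreasing_map (\<lambda>x. 0)"
  unfolding norm_decreasing_map_def frechet_holomorphic_on_def
  by (auto intro!: exI[of _ "\<lambda>x. 0"] complex_linear_zero)

lemma norm_decreasing_map_id: "norm_decreasing_map (\<lambda>x. x)"
  unfolding norm_decreasing_map_def frechet_holomorphic_on_def
  by (auto intro!: exI[of _ "\<lambda>x. x"] simp: complex_linear_def)

lemma norm_decreasing_map_comp:
  assumes \<psi>: "norm_decreasing_map \<psi>" and \<eta>: "norm_decreasing_map \<eta>"
  shows "norm_decreasing_map (\<psi> \<circ> \<eta>)"
  unfolding norm_decreasing_map_def frechet_holomorphic_on_def
proof (intro conjI ballI)
  fix x :: 'a assume x: "x \<in> ball 0 1"
  have \<eta>x: "norm (\<eta> x) \<le> norm x"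
    using \<eta> x unfolding norm_decreasing_map_def by blast
  then have mem: "\<eta> x \<in> ball 0 1"
    using x by simp
  show "norm ((\<psi> \<circ> \<eta>) x) \<le> norm x"
    using \<psi> mem \<eta>x unfolding norm_decreasing_map_def by fastforce
  obtain D where D: "complex_linear D" "(\<eta> has_derivative D) (at x)"
    using \<eta> x unfolding norm_decreasing_map_def frechet_holomorphic_on_def by blast
  obtain E where E: "complex_linear E" "(\<psi> has_derivative E) (at (\<eta> x))"
    using \<psi> mem unfolding norm_decreasing_map_def frechet_holomorphic_on_def by blast
  have "complex_linear (E \<circ> D)"
    using D(1) E(1) by (simp add: complex_linear_def)
  then show "\<exists>D. complex_linear D \<and> (\<psi> \<circ> \<eta> has_derivative D) (at x)"
    using diff_chain_at[OF D(2) E(2)] by blast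
qed

lemma norm_decreasing_map_funpow:
  "norm_decreasing_map \<psi> \<Longrightarrow> norm_decreasing_map (\<psi> ^^ n)"
  by (induction n)
    (auto simp: norm_decreasing_map_id id_def intro: norm_decreasing_map_comp)

lemma norm_decreasing_map_mem_ball:
  "norm_decreasing_map \<psi> \<Longrightarrow> r \<le> 1 \<Longrightarrow> x \<in> ball 0 r \<Longrightarrow> \<psi> x \<in> ball 0 r"
  unfolding norm_decreasing_map_def by (fastforce dest: bspec[of _ _ x])

lemma Rep_comp_op_norm_decreasing:
  assumes "norm_decreasing_map \<psi>"
  shows "Rep_Hb (comp_op \<psi> f) x = (if x \<in> ball 0 1 then Rep_Hb f (\<psi> x) else 0)"
proof (rule Rep_comp_op)
  show "frechet_holomorphic_on \<psi> (ball 0 1)"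
    using assms unfolding norm_decreasing_map_def by blast
  show "\<psi> ` ball 0 1 \<subseteq> ball 0 1"
    using norm_decreasing_map_mem_ball[OF assms order_refl] by blast
  fix A :: "'a set" assume "BX_bounded A"
  then obtain r where r: "0 < r" "r < 1" "A \<subseteq> ball 0 r"
    unfolding BX_bounded_def by blast
  then have "\<psi> ` A \<subseteq> ball 0 r"
    using norm_decreasing_map_mem_ball[OF assms, of r] by auto
  then show "BX_bounded (\<psi> ` A)"
    using r unfolding BX_bounded_def by blast
qed

lemma funpow_comp_op:
  assumes "norm_decreasing_map \<psi>"
  shows "comp_op \<psi> ^^ n = comp_op (\<psi> ^^ n)"
proof (induction n)
  case 0
  show ?case
    by (intro ext Hb_eqI)
      (auto simp: Rep_comp_op_norm_decreasing norm_decreasing_map_id Rep_Hb_outside id_def)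
next
  case (Suc n)
  have "comp_op (\<psi> ^^ Suc n) f = comp_op \<psi> (comp_op (\<psi> ^^ n) f)" for f
  proof (rule Hb_eqI)
    fix x
    have "x \<in> ball 0 1 \<Longrightarrow> \<psi> x \<in> ball 0 1"
      using norm_decreasing_map_mem_ball[OF assms order_refl] .
    then show "Rep_Hb (comp_op (\<psi> ^^ Suc n) f) x = Rep_Hb (comp_op \<psi> (comp_op (\<psi> ^^ n) f)) x"
      using norm_decreasing_map_funpow[OF assms]
      by (simp only: Rep_comp_op_norm_decreasing assms) (simp add: funpow_swap1)
  qed
  then show ?case
    unfolding funpow.simps(2)[of n "comp_op \<psi>"] Suc.IH by (intro ext) (simp only: o_apply)
qed

lemma complex_linear_comp_op: "norm_decreasing_map \<psi> \<Longrightarrow> complex_linear (comp_op \<psi>)"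
  unfolding complex_linear_def
  by (auto intro!: Hb_eqI simp: Rep_comp_op_norm_decreasing Rep_Hb_simps)

text \<open>This is where the hypothesis on \<open>\<phi>\<close> becomes quantitative. The Schwarz lemma is used on
  \<open>f \<circ> \<phi>\<^sup>k\<close>, whose value at \<open>0\<close> does not depend on \<open>k\<close>.\<close>

lemma comp_op_funpow_geometric:
  assumes \<phi>: "norm_decreasing_map \<phi>" and t: "0 < t" "t < 1"
    and \<rho>: "0 \<le> \<rho>" "\<phi> ` ball 0 t \<subseteq> ball 0 \<rho>" "\<rho> \<le> t"
    and K: "\<And>y. y \<in> ball 0 t \<Longrightarrow> norm (Rep_Hb f y - Rep_Hb f 0) \<le> K"
    and x: "x \<in> ball 0 t"
  shows "norm (Rep_Hb (comp_op (\<phi> ^^ n) f) x - Rep_Hb f 0) \<le> (\<rho> / t) ^ n * K"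
  using K x
proof (induction n arbitrary: x)
  case 0
  then show ?case
    using t by (simp add: Rep_comp_op_norm_decreasing norm_decreasing_map_id id_def)
next
  case (Suc n)
  let ?g = "Rep_Hb (comp_op (\<phi> ^^ n) f)"
  have pow: "norm_decreasing_map (\<phi> ^^ n)" for n
    by (rule norm_decreasing_map_funpow[OF \<phi>])
  have "norm ((\<phi> ^^ n) 0) \<le> norm (0 :: 'a)"
    using pow[of n] unfolding norm_decreasing_map_def by (metis centre_in_ball zero_less_one)
  then have g0: "?g 0 = Rep_Hb f 0"
    using pow[of n] by (simp add: Rep_comp_op_norm_decreasing)
  have \<phi>x: "\<phi> x \<in> ball 0 \<rho>"
    using \<rho>(2) Suc.prems(2) by blast
  have "frechet_holomorphic_on ?g (ball 0 t)"
    using Rep_Hb[of "comp_op (\<phi> ^^ n) f"] t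
    unfolding Hb_functions_def frechet_holomorphic_on_def by auto
  moreover have "norm (?g y - ?g 0) \<le> (\<rho> / t) ^ n * K" if "y \<in> ball 0 t" for y
    unfolding g0 by (rule Suc.IH[OF Suc.prems(1) that])
  moreover have "\<phi> x \<in> ball 0 t"
    using \<phi>x \<rho>(3) by simp
  ultimately have "norm (?g (\<phi> x) - ?g 0) \<le> (\<rho> / t) ^ n * K * (norm (\<phi> x) / t)"
    by (rule Schwarz_ball)
  also have "\<dots> \<le> (\<rho> / t) ^ n * K * (\<rho> / t)"
  proof (rule mult_left_mono)
    show "norm (\<phi> x) / t \<le> \<rho> / t"
      using \<phi>x t by (simp add: divide_right_mono)
    have "0 \<le> K"
      using Suc.prems(1)[of 0] t by simp
    then show "0 \<le> (\<rho> / t) ^ n * K"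
      using \<rho>(1) t by simp
  qed
  finally have "norm (?g (\<phi> x) - Rep_Hb f 0) \<le> (\<rho> / t) ^ Suc n * K"
    unfolding g0 by (simp add: mult_ac)
  moreover have "Rep_Hb (comp_op (\<phi> ^^ Suc n) f) x = ?g (\<phi> x)"
    using Suc.prems(2) t norm_decreasing_map_mem_ball[OF \<phi> order_refl, of x]
    by (simp only: Rep_comp_op_norm_decreasing[OF pow]) (simp add: funpow_swap1)
  ultimately show ?case
    by (simp only:)
qed

section \<open>Operators controlled by suprema over balls\<close>

text \<open>The operators met here, \<open>C\<^sub>\<psi>\<close> for norm-decreasing \<open>\<psi>\<close> and averages of such operators, do
  not increase the supremum over any \<open>r B\<^sub>X\<close>, so the same seminorm controls input and output.\<close>

definition ball_contractive :: "('a::complex_banach Hb \<Rightarrow> 'a Hb) \<Rightarrow> bool" where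
  "ball_contractive T \<longleftrightarrow> (\<forall>r f M. 0 < r \<longrightarrow> r < 1 \<longrightarrow>
     (\<forall>y\<in>ball 0 r. norm (Rep_Hb f y) \<le> M) \<longrightarrow> (\<forall>x\<in>ball 0 r. norm (Rep_Hb (T f) x) \<le> M))"

lemma lin_opsI_ball_contractive:
  fixes T :: "'a::complex_banach Hb \<Rightarrow> 'a Hb"
  assumes lin: "complex_linear T" and contr: "ball_contractive T"
  shows "T \<in> lin_ops"
proof -
  have "filterlim T (nhds (T f)) (nhds f)" for f
  proof (rule filterlim_nhds_HbI)
    fix A :: "'a set" and e :: real
    assume A: "BX_bounded A" and e: "0 < e"
    obtain r where r: "0 < r" "r < 1" "A \<subseteq> ball 0 r"
      using A unfolding BX_bounded_def by blast
    then have ball: "BX_bounded (ball 0 r :: 'a set)"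
      unfolding BX_bounded_def by blast
    have "T g \<in> Hb_nbhd (T f) A e" if g: "g \<in> Hb_nbhd f (ball 0 r) (e / 2)" for g
    proof -
      have diff: "T (g - f) = T g - T f"
        using lin unfolding complex_linear_def by (metis add_diff_cancel diff_add_cancel)
      have "\<forall>y\<in>ball 0 r. norm (Rep_Hb (g - f) y) \<le> e / 2"
        using g unfolding Hb_nbhd_def by (auto simp: Rep_minus_Hb intro: less_imp_le)
      then have "\<forall>x\<in>ball 0 r. norm (Rep_Hb (T (g - f)) x) \<le> e / 2"
        using contr r unfolding ball_contractive_def by blast
      then show ?thesis
        using r(3) e unfolding Hb_nbhd_def diff by (fastforce simp: Rep_minus_Hb)
    qed
    then show "eventually (\<lambda>g. T g \<in> Hb_nbhd (T f) A e) (nhds f)"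
      using e by (intro eventually_mono[OF eventually_Hb_nbhd[OF ball, of "e / 2" f]]) auto
  qed
  then have "(T \<longlongrightarrow> T f) (at f)" for f
    by (rule filterlim_mono) (auto simp: at_within_def)
  then show ?thesis
    using lin unfolding lin_ops_def by (auto simp: continuous_on_def)
qed

lemma ball_contractive_comp_op:
  assumes "norm_decreasing_map \<psi>"
  shows "ball_contractive (comp_op \<psi>)"
  unfolding ball_contractive_def
proof (intro allI impI ballI)
  fix r M :: real and f :: "'a Hb" and x :: 'a
  assume "0 < r" "r < 1" "\<forall>y\<in>ball 0 r. norm (Rep_Hb f y) \<le> M" "x \<in> ball 0 r"
  then show "norm (Rep_Hb (comp_op \<psi> f) x) \<le> M"
    using norm_decreasing_map_mem_ball[OF assms, of r x]
    by (simp add: Rep_comp_op_norm_decreasing[OF assms])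
qed

lemma comp_op_lin_ops: "norm_decreasing_map \<psi> \<Longrightarrow> comp_op \<psi> \<in> lin_ops"
  by (intro lin_opsI_ball_contractive complex_linear_comp_op ball_contractive_comp_op)

text \<open>A bounded set is absorbed by the neighbourhood of \<open>0\<close> of all functions that are at most \<open>1\<close>
  on \<open>A\<close>, and the absorbing scalar is the uniform bound.\<close>

lemma vN_bounded_imp_uniformly_bounded:
  fixes B :: "'a::complex_banach Hb set"
  assumes "vN_bounded B" "BX_bounded A"
  obtains M where "\<And>f x. f \<in> B \<Longrightarrow> x \<in> A \<Longrightarrow> norm (Rep_Hb f x) \<le> M"
proof -
  let ?U = "Hb_inner (0 :: 'a Hb) A 1"
  have "open ?U" "0 \<in> ?U"
    using assms(2) by (auto intro: open_Hb_inner mem_Hb_inner)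
  then obtain s where s: "s > 0" "\<And>c. s \<le> norm c \<Longrightarrow> B \<subseteq> (\<lambda>v. c *\<^sub>C v) ` ?U"
    using assms(1) unfolding vN_bounded_def by blast
  have "norm (Rep_Hb f x) \<le> s" if "f \<in> B" "x \<in> A" for f x
  proof -
    have "s \<le> norm (complex_of_real s)"
      by simp
    from subsetD[OF s(2)[OF this] that(1)]
    obtain g where g: "g \<in> ?U" "f = complex_of_real s *\<^sub>C g"
      by (elim imageE)
    have "norm (Rep_Hb g x) \<le> 1"
      using g(1) that(2) unfolding Hb_inner_def by (force simp: Rep_zero_Hb)
    then show ?thesis
      using s(1) g(2) by (simp add: Rep_scaleC_Hb norm_mult)
  qed
  then show ?thesis
    using that by blast
qed

text \<open>An estimate that is linear in the supremum \<open>M\<close> of \<open>f\<close> is uniform over a bounded set, as all its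
  members share one \<open>M\<close>. The index \<open>0\<close> is left out because the Cesaro mean over no terms is the
  zero operator, for which the geometric bound says nothing.\<close>

lemma limitin_bc_topologyI:
  fixes S :: "nat \<Rightarrow> 'a::complex_banach Hb \<Rightarrow> 'a Hb"
  assumes S: "\<And>n. S n \<in> lin_ops" and P: "P \<in> lin_ops"
    and est: "\<And>r. 0 < r \<Longrightarrow> r < 1 \<Longrightarrow> \<exists>c. c \<longlonglongrightarrow> 0 \<and>
      (\<forall>n>0. \<forall>f M. (\<forall>y\<in>ball 0 r. norm (Rep_Hb f y) \<le> M) \<longrightarrow>
        (\<forall>x\<in>ball 0 r. norm (Rep_Hb (S n f) x - Rep_Hb (P f) x) \<le> c n * M))"
  shows "limitin bc_topology S P sequentially"
  unfolding limitin_def topspace_bc_topology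
proof (intro conjI allI impI)
  show "P \<in> lin_ops" by fact
  fix W assume W: "openin bc_topology W \<and> P \<in> W"
  then obtain B U where BU: "vN_bounded B" "open U" "0 \<in> U"
      "{T \<in> lin_ops. \<forall>v\<in>B. T v - P v \<in> U} \<subseteq> W"
    unfolding openin_bc_topology by blast
  obtain A e where A: "BX_bounded A" "0 < e" "Hb_nbhd 0 A e \<subseteq> U"
    by (rule open_Hb_nbhd[OF BU(2,3)])
  obtain r where r: "0 < r" "r < 1" "A \<subseteq> ball 0 r"
    using A(1) unfolding BX_bounded_def by blast
  then have "BX_bounded (ball 0 r :: 'a set)"
    unfolding BX_bounded_def by blast
  then obtain M where M: "\<And>f x. f \<in> B \<Longrightarrow> x \<in> ball 0 r \<Longrightarrow> norm (Rep_Hb f x) \<le> M"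
    using vN_bounded_imp_uniformly_bounded[OF BU(1)] by blast
  obtain c where c: "c \<longlonglongrightarrow> 0"
    and bound: "\<forall>n>0. \<forall>f M. (\<forall>y\<in>ball 0 r. norm (Rep_Hb f y) \<le> M) \<longrightarrow>
      (\<forall>x\<in>ball 0 r. norm (Rep_Hb (S n f) x - Rep_Hb (P f) x) \<le> c n * M)"
    using est[OF r(1,2)] by (elim exE conjE)
  have "(\<lambda>n. c n * M) \<longlonglongrightarrow> 0"
    by (rule tendsto_mult_left_zero[OF c])
  then have "eventually (\<lambda>n. c n * M < e) sequentially"
    using A(2) by (rule order_tendstoD(2))
  then show "eventually (\<lambda>n. S n \<in> W) sequentially"
    using eventually_gt_at_top[of 0]
  proof eventually_elim
    case (elim n)
    have "S n f - P f \<in> Hb_nbhd 0 A e" if "f \<in> B" for f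
      unfolding Hb_nbhd_def
    proof (intro CollectI ballI)
      fix x assume "x \<in> A"
      then have "norm (Rep_Hb (S n f) x - Rep_Hb (P f) x) \<le> c n * M"
        using r(3) by (intro bound[rule_format, OF elim(2) M[OF that]]) blast+
      then show "norm (Rep_Hb (S n f - P f) x - Rep_Hb 0 x) < e"
        using elim(1) by (simp add: Rep_Hb_simps)
    qed
    then show ?case
      using A(3) BU(4) S[of n] by blast
  qed
qed

section \<open>Cesaro means\<close>

lemma Rep_sum_Hb: "Rep_Hb (\<Sum>i\<in>I. F i :: 'a::complex_banach Hb) x = (\<Sum>i\<in>I. Rep_Hb (F i) x)"
  by (induction I rule: infinite_finite_induct) (simp_all add: Rep_Hb_simps)

lemma Rep_cesaro_mean:
  "Rep_Hb (cesaro_mean T n f) x = (\<Sum>k<n. Rep_Hb ((T ^^ k) f) x) / of_nat n"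
  by (simp add: cesaro_mean_def Rep_scaleC_Hb Rep_sum_Hb)

lemma norm_Rep_cesaro_mean_diff_le:
  assumes "0 < n" and "\<And>k. norm (Rep_Hb ((T ^^ k) f) x - w) \<le> b k"
  shows "norm (Rep_Hb (cesaro_mean T n f) x - w) \<le> (\<Sum>k<n. b k) / n"
proof -
  have "Rep_Hb (cesaro_mean T n f) x - w = (\<Sum>k<n. Rep_Hb ((T ^^ k) f) x - w) / of_nat n"
    using assms(1) by (simp add: Rep_cesaro_mean sum_subtractf divide_simps)
  also have "norm \<dots> \<le> (\<Sum>k<n. b k) / n"
    by (auto simp: norm_divide intro!: divide_right_mono sum_norm_le assms(2))
  finally show ?thesis .
qed

lemma cesaro_mean_comp_op_lin_ops:
  assumes \<psi>: "norm_decreasing_map \<psi>"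
  shows "cesaro_mean (comp_op \<psi>) n \<in> lin_ops"
proof (rule lin_opsI_ball_contractive)
  have pow: "norm_decreasing_map (\<psi> ^^ k)" for k
    by (rule norm_decreasing_map_funpow[OF \<psi>])
  have add: "comp_op (\<psi> ^^ k) (f + g) = comp_op (\<psi> ^^ k) f + comp_op (\<psi> ^^ k) g"
    and scale: "comp_op (\<psi> ^^ k) (c *\<^sub>C f) = c *\<^sub>C comp_op (\<psi> ^^ k) f" for k f g c
    using complex_linear_comp_op[OF pow[of k]] unfolding complex_linear_def by blast+
  show "complex_linear (cesaro_mean (comp_op \<psi>) n)"
    unfolding complex_linear_def
    by (intro conjI allI; rule Hb_eqI)
      (simp_all add: Rep_cesaro_mean funpow_comp_op[OF \<psi>] add scale Rep_Hb_simps sum.distrib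
        sum_distrib_left add_divide_distrib)
  show "ball_contractive (cesaro_mean (comp_op \<psi>) n)"
    unfolding ball_contractive_def
  proof (intro allI impI ballI)
    fix r M :: real and f :: "'a Hb" and x :: 'a
    assume r: "0 < r" "r < 1" and f: "\<forall>y\<in>ball 0 r. norm (Rep_Hb f y) \<le> M"
      and x: "x \<in> ball 0 r"
    have "norm (Rep_Hb ((comp_op \<psi> ^^ k) f) x - 0) \<le> M" for k
      using ball_contractive_comp_op[OF pow[of k]] r f x
      unfolding ball_contractive_def funpow_comp_op[OF \<psi>] by simp
    then have "norm (Rep_Hb (cesaro_mean (comp_op \<psi>) n f) x - 0) \<le> (\<Sum>k<n. M) / n" if "0 < n"
      by (rule norm_Rep_cesaro_mean_diff_le[OF that])
    moreover have "0 \<le> M"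
      using f x norm_ge_zero order_trans by blast
    \<comment> \<open>The empty mean is the zero operator.\<close>
    ultimately show "norm (Rep_Hb (cesaro_mean (comp_op \<psi>) n f) x) \<le> M"
      by (cases "n = 0") (simp_all add: Rep_cesaro_mean)
  qed
qed

section \<open>Convergence of the iterates and of their means\<close>

theorem theorem5p8:
  fixes \<phi> :: "'a::complex_banach \<Rightarrow> 'a"
  assumes "frechet_holomorphic_on \<phi> (ball 0 1)"
    and "\<phi> ` ball 0 1 \<subseteq> ball 0 1"
    and "\<And>t. 0 < t \<Longrightarrow> t < 1 \<Longrightarrow> \<exists>\<rho>. 0 < \<rho> \<and> \<rho> < t \<and> \<phi> ` ball 0 t \<subseteq> ball 0 \<rho>"
  shows "limitin bc_topology (\<lambda>n. comp_op (\<phi> ^^ n)) (comp_op (\<lambda>x. 0)) sequentially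
    \<and> limitin bc_topology (cesaro_mean (comp_op \<phi>)) (comp_op (\<lambda>x. 0)) sequentially
    \<and> uniformly_mean_ergodic (comp_op \<phi>)"
proof -
  \<comment> \<open>The hypothesis at all radii \<open>t\<close> slightly larger than \<open>\<parallel>x\<parallel>\<close> bounds \<open>\<parallel>\<phi>(x)\<parallel>\<close> by \<open>\<parallel>x\<parallel>\<close>.\<close>
  have "norm (\<phi> x) \<le> norm x" if x: "x \<in> ball 0 1" for x
  proof (rule dense_ge_bounded)
    show "norm x < 1"
      using x by simp
    fix t assume t: "norm x < t" "t < 1"
    then have "0 < t"
      using norm_ge_zero[of x] by linarith
    then obtain \<rho> where "\<rho> < t" "\<phi> ` ball 0 t \<subseteq> ball 0 \<rho>"
      using assms(3) t by blast
    then have "norm (\<phi> x) < \<rho>"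
      using t by (simp add: image_subset_iff)
    then show "norm (\<phi> x) \<le> t"
      using \<open>\<rho> < t\<close> by simp
  qed
  then have \<phi>: "norm_decreasing_map \<phi>"
    using assms(1) unfolding norm_decreasing_map_def by blast
  note pow = norm_decreasing_map_funpow[OF \<phi>]
  note zero_op = comp_op_lin_ops[OF norm_decreasing_map_zero]

  have geometric: "\<exists>q. 0 \<le> q \<and> q < 1 \<and> (\<forall>n f M. (\<forall>y\<in>ball 0 r. norm (Rep_Hb f y) \<le> M) \<longrightarrow>
      (\<forall>x\<in>ball 0 r. norm (Rep_Hb (comp_op (\<phi> ^^ n) f) x - Rep_Hb (comp_op (\<lambda>x. 0) f) x)
        \<le> 2 * q ^ n * M))" if r: "0 < r" "r < 1" for r
  proof -
    obtain \<rho> where \<rho>: "0 < \<rho>" "\<rho> < r" "\<phi> ` ball 0 r \<subseteq> ball 0 \<rho>"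
      using assms(3)[OF r] by blast
    have "norm (Rep_Hb (comp_op (\<phi> ^^ n) f) x - Rep_Hb (comp_op (\<lambda>x. 0) f) x)
        \<le> 2 * (\<rho> / r) ^ n * M"
      if f: "\<forall>y\<in>ball 0 r. norm (Rep_Hb f y) \<le> M" and x: "x \<in> ball 0 r" for n f M x
    proof -
      have "norm (Rep_Hb f y - Rep_Hb f 0) \<le> 2 * M" if "y \<in> ball 0 r" for y
      proof -
        have "norm (Rep_Hb f y) \<le> M" "norm (Rep_Hb f 0) \<le> M"
          using f that r by (blast, simp)
        then show ?thesis
          using norm_triangle_ineq4[of "Rep_Hb f y" "Rep_Hb f 0"] by linarith
      qed
      then have "norm (Rep_Hb (comp_op (\<phi> ^^ n) f) x - Rep_Hb f 0) \<le> (\<rho> / r) ^ n * (2 * M)"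
        using \<rho> by (intro comp_op_funpow_geometric[OF \<phi> r _ _ _ _ x]) auto
      then show ?thesis
        using x r by (simp add: Rep_comp_op_norm_decreasing[OF norm_decreasing_map_zero] mult_ac)
    qed
    then show ?thesis
      using \<rho> r by (intro exI[of _ "\<rho> / r"]) auto
  qed

  have iterates: "limitin bc_topology (\<lambda>n. comp_op (\<phi> ^^ n)) (comp_op (\<lambda>x. 0)) sequentially"
  proof (rule limitin_bc_topologyI[OF comp_op_lin_ops[OF pow] zero_op])
    fix r :: real assume "0 < r" "r < 1"
    from geometric[OF this] obtain q where q: "0 \<le> q" "q < 1"
      and est: "\<forall>n f M. (\<forall>y\<in>ball 0 r. norm (Rep_Hb f y) \<le> M) \<longrightarrow>
        (\<forall>x\<in>ball 0 r. norm (Rep_Hb (comp_op (\<phi> ^^ n) f) x - Rep_Hb (comp_op (\<lambda>x. 0) f) x)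
          \<le> 2 * q ^ n * M)"
      by blast
    have "(\<lambda>n. 2 * q ^ n) \<longlonglongrightarrow> 0"
      using q by (intro tendsto_mult_right_zero LIMSEQ_power_zero) simp
    then show "\<exists>c. c \<longlonglongrightarrow> 0 \<and>
      (\<forall>n>0. \<forall>f M. (\<forall>y\<in>ball 0 r. norm (Rep_Hb f y) \<le> M) \<longrightarrow>
        (\<forall>x\<in>ball 0 r. norm (Rep_Hb (comp_op (\<phi> ^^ n) f) x - Rep_Hb (comp_op (\<lambda>x. 0) f) x)
          \<le> c n * M))"
      using est by (intro exI[of _ "\<lambda>n. 2 * q ^ n"]) blast
  qed

  have means: "limitin bc_topology (cesaro_mean (comp_op \<phi>)) (comp_op (\<lambda>x. 0)) sequentially"
  proof (rule limitin_bc_topologyI[OF cesaro_mean_comp_op_lin_ops[OF \<phi>] zero_op])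
    fix r :: real assume r: "0 < r" "r < 1"
    from geometric[OF this] obtain q where q: "0 \<le> q" "q < 1"
      and est: "\<forall>n f M. (\<forall>y\<in>ball 0 r. norm (Rep_Hb f y) \<le> M) \<longrightarrow>
        (\<forall>x\<in>ball 0 r. norm (Rep_Hb (comp_op (\<phi> ^^ n) f) x - Rep_Hb (comp_op (\<lambda>x. 0) f) x)
          \<le> 2 * q ^ n * M)"
      by blast
    define c where "c n = 2 / (1 - q) / real n" for n
    have "c \<longlonglongrightarrow> 0"
      unfolding c_def by (rule lim_const_over_n)
    moreover have "norm (Rep_Hb (cesaro_mean (comp_op \<phi>) n f) x - Rep_Hb (comp_op (\<lambda>x. 0) f) x)
        \<le> c n * M"
      if n: "n > 0" and f: "\<forall>y\<in>ball 0 r. norm (Rep_Hb f y) \<le> M" and x: "x \<in> ball 0 r" for n f M x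
    proof -
      have M: "0 \<le> M"
        using f x norm_ge_zero order_trans by blast
      have "norm (Rep_Hb (cesaro_mean (comp_op \<phi>) n f) x - Rep_Hb (comp_op (\<lambda>x. 0) f) x)
          \<le> (\<Sum>k<n. 2 * q ^ k * M) / n"
        by (intro norm_Rep_cesaro_mean_diff_le[OF n])
          (unfold funpow_comp_op[OF \<phi>], rule est[rule_format, OF f[rule_format] x])
      also have "(\<Sum>k<n. 2 * q ^ k * M) = 2 * M * (\<Sum>k<n. q ^ k)"
        by (simp add: sum_distrib_left mult_ac)
      also have "\<dots> \<le> 2 * M * (1 / (1 - q))"
      proof (rule mult_left_mono)
        have "(\<Sum>k<n. q ^ k) = (1 - q ^ n) / (1 - q)"
          using q by (simp add: sum_gp_strict)
        also have "\<dots> \<le> 1 / (1 - q)"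
          using q by (intro divide_right_mono) auto
        finally show "(\<Sum>k<n. q ^ k) \<le> 1 / (1 - q)" .
      qed (use M in simp)
      finally show ?thesis
        by (simp add: c_def divide_right_mono mult_ac)
    qed
    ultimately show "\<exists>c. c \<longlonglongrightarrow> 0 \<and>
      (\<forall>n>0. \<forall>f M. (\<forall>y\<in>ball 0 r. norm (Rep_Hb f y) \<le> M) \<longrightarrow>
        (\<forall>x\<in>ball 0 r. norm (Rep_Hb (cesaro_mean (comp_op \<phi>) n f) x - Rep_Hb (comp_op (\<lambda>x. 0) f) x)
          \<le> c n * M))"
      by blast
  qed

  have "uniformly_mean_ergodic (comp_op \<phi>)"
    unfolding uniformly_mean_ergodic_def using comp_op_lin_ops[OF \<phi>] means by blast
  with iterates means show ?thesis
    by blast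
qed

end
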